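(* Let $(G_L,G_C)$ be a generating set of the cone $C(A,\mathcal K,\mathcal B)$. Suppose that for each $\delta\in\mathcal K^*\setminus\{0\}$ there exists $x_\delta\in\mathcal S(A,\mathcal K,\mathcal B)$ with $\langle\delta,x_\delta\rangle>0$. Then every valid equation in $G_L$, and every generating valid inequality $(\mu;\eta_0)\in G_C^+$ with $\mu\neq0$, is $\mathcal K$-minimal.
   Context: Setting: $E$ is a finite-dimensional Euclidean space with inner product $\langle\cdot,\cdot\rangle$; $\mathcal K\subset E$ is a regular cone (closed, convex, pointed, full-dimensional); $\mathcal K^*=\{y\in E:\langle x,y\rangle\ge0\ \forall x\in\mathcal K\}$ is its dual cone; $A:E\to\mathbb R^m$ is linear; $\mathcal B\subseteq\mathbb R^m$ is an arbitrary nonempty set; $\mathcal S(A,\mathcal K,\mathcal B)=\{x\in\mathcal K: Ax\in\mathcal B\}$, assumed to satisfy $\mathcal S(A,\mathcal K,\mathcal B)\neq\emptyset$ and $\mathcal S(A,\mathcal K,\mathcal B)\ne\mathcal K$. A pair $(\mu;\eta_0)\in E\times\mathbb R$ is a valid inequality if $\langle\mu,x\rangle\ge\eta_0$ for all $x\in \mathcal S(A,\mathcal K,\mathcal B)$; it is a valid equation if both $(\mu;\eta_0)$ and $(-\mu;-\eta_0)$ are valid. $C(A,\mathcal K,\mathcal B)\subset E\times\mathbb R$ is the convex cone of all valid inequalities. A cone-implied inequality is one of the form $(\delta;0)$ with $\delta\in\mathcal K^*$. A valid inequality $(\mu;\eta_0)$ with $\mu\neq0$ is $\mathcal K$-minimal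 if every valid inequality $(\rho;\rho_0)$ with $\rho\ne\mu$ and $\mu-\rho\in\mathcal K^*$ satisfies $\rho_0<\eta_0$. Let $L$ be the largest linear subspace contained in $C(A,\mathcal K,\mathcal B)$ and $C=C(A,\mathcal K,\mathcal B)\cap L^\perp$ (a pointed cone), so $C(A,\mathcal K,\mathcal B)=L+C$. A generating set $(G_L,G_C)$ of $C(A,\mathcal K,\mathcal B)$ is a (inclusionwise) minimal collection of elements with $G_L\subseteq L$, $G_C\subseteq C$ such that $C(A,\mathcal K,\mathcal B)=\{\sum_{w\in G_L}\alpha_w w+\sum_{v\in G_C}\lambda_v v:\ \alpha_w\in\mathbb R,\ \lambda_v\ge0\}$ (finite sums). A vector $u$ is an $L$-multiple of $v$ if $u=\tau v+\ell$ for some $\tau>0$ and $\ell\in L$. $G_C^+$ denotes the set of vectors of $G_C$ that are not $L$-multiples of any cone-implied inequality $(\delta;0)$ with $\delta\in\mathcal K^*\setminus\{0\}$. *)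

theory Defs
  imports "HOL-Analysis.Analysis"
begin

definition regular_cone :: "'a::euclidean_space set \<Rightarrow> bool" where
  "regular_cone K \<longleftrightarrow>
     cone K \<and> closed K \<and> convex K \<and> K \<inter> uminus ` K = {0} \<and> interior K \<noteq> {}"

definition dual_cone :: "'a::euclidean_space set \<Rightarrow> 'a set" where
  "dual_cone K = {y. \<forall>x\<in>K. 0 \<le> x \<bullet> y}"

definition feasible_set :: "('a::euclidean_space \<Rightarrow> real ^ 'm) \<Rightarrow> 'a set \<Rightarrow> (real ^ 'm) set \<Rightarrow> 'a set" where
  "feasible_set A K B = {x \<in> K. A x \<in> B}"

definition valid_inequality ::
  "('a::euclidean_space \<Rightarrow> real ^ 'm) \<Rightarrow> 'a set \<Rightarrow> (real ^ 'm) set \<Rightarrow> 'a \<times> real \<Rightarrow> bool" where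
  "valid_inequality A K B = (\<lambda>(\<mu>, \<eta>). \<forall>x\<in>feasible_set A K B. \<eta> \<le> \<mu> \<bullet> x)"

definition valid_equation ::
  "('a::euclidean_space \<Rightarrow> real ^ 'm) \<Rightarrow> 'a set \<Rightarrow> (real ^ 'm) set \<Rightarrow> 'a \<times> real \<Rightarrow> bool" where
  "valid_equation A K B = (\<lambda>(\<mu>, \<eta>). valid_inequality A K B (\<mu>, \<eta>) \<and> valid_inequality A K B (- \<mu>, - \<eta>))"

definition valid_cone ::
  "('a::euclidean_space \<Rightarrow> real ^ 'm) \<Rightarrow> 'a set \<Rightarrow> (real ^ 'm) set \<Rightarrow> ('a \<times> real) set" where
  "valid_cone A K B = {w. valid_inequality A K B w}"

definition K_minimal ::
  "('a::euclidean_space \<Rightarrow> real ^ 'm) \<Rightarrow> 'a set \<Rightarrow> (real ^ 'm) set \<Rightarrow> 'a \<times> real \<Rightarrow> bool" where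
  "K_minimal A K B = (\<lambda>(\<mu>, \<eta>).
     valid_inequality A K B (\<mu>, \<eta>) \<and> \<mu> \<noteq> 0 \<and>
     (\<forall>\<rho> \<rho>\<^sub>0. valid_inequality A K B (\<rho>, \<rho>\<^sub>0) \<and> \<rho> \<noteq> \<mu> \<and> \<mu> - \<rho> \<in> dual_cone K \<longrightarrow> \<rho>\<^sub>0 < \<eta>))"

definition largest_subspace :: "'v::real_vector set \<Rightarrow> 'v set" where
  "largest_subspace C = (GREATEST M. subspace M \<and> M \<subseteq> C)"

definition pointed_part :: "'v::euclidean_space set \<Rightarrow> 'v set" where
  "pointed_part C = C \<inter> orthogonal_comp (largest_subspace C)"

text \<open>All finite sums with arbitrary real coefficients on the first set and nonnegative ones on the
  second; both sets may be infinite.\<close>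

definition generated :: "'v::real_vector set \<Rightarrow> 'v set \<Rightarrow> 'v set" where
  "generated G H =
     {(\<Sum>w\<in>S. \<alpha> w *\<^sub>R w) + (\<Sum>v\<in>T. c v *\<^sub>R v) | S T \<alpha> c.
        finite S \<and> S \<subseteq> G \<and> finite T \<and> T \<subseteq> H \<and> (\<forall>v\<in>T. 0 \<le> c v)}"

definition generates :: "'v::euclidean_space set \<Rightarrow> 'v set \<Rightarrow> 'v set \<Rightarrow> bool" where
  "generates C G H \<longleftrightarrow>
     G \<subseteq> largest_subspace C \<and> H \<subseteq> pointed_part C \<and> C = generated G H"

definition generating_set :: "'v::euclidean_space set \<Rightarrow> 'v set \<Rightarrow> 'v set \<Rightarrow> bool" where
  "generating_set C G H \<longleftrightarrow>
     generates C G H \<and>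
     (\<forall>G' H'. G' \<subseteq> G \<and> H' \<subseteq> H \<and> generates C G' H' \<longrightarrow> G' = G \<and> H' = H)"

definition L_multiple :: "'v::real_vector set \<Rightarrow> 'v \<Rightarrow> 'v \<Rightarrow> bool" where
  "L_multiple L u v \<longleftrightarrow> (\<exists>\<tau>>0. \<exists>l\<in>L. u = \<tau> *\<^sub>R v + l)"

definition G_plus ::
  "('a::euclidean_space \<Rightarrow> real ^ 'm) \<Rightarrow> 'a set \<Rightarrow> (real ^ 'm) set \<Rightarrow> ('a \<times> real) set \<Rightarrow> ('a \<times> real) set" where
  "G_plus A K B G\<^sub>C =
     {v \<in> G\<^sub>C. \<not> (\<exists>\<delta>\<in>dual_cone K - {0}. L_multiple (largest_subspace (valid_cone A K B)) v (\<delta>, 0))}"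

text \<open>The description of the greatest subspace in \<^const>\<open>largest_subspace\<close> is meaningful for the cone
  of valid inequalities: this subspace exists and consists of the valid equations.\<close>

lemma largest_subspace_valid_cone:
  "largest_subspace (valid_cone A K B) = {w. valid_equation A K B w}"
  (is "_ = ?M")
  unfolding largest_subspace_def
proof (rule Greatest_equality)
  have "?M = {w. \<forall>x\<in>feasible_set A K B. fst w \<bullet> x = snd w}"
    by (auto simp: valid_equation_def valid_inequality_def intro: order_antisym)
  moreover have "subspace \<dots>"
    by (auto simp: subspace_def inner_add_left)
  moreover have "?M \<subseteq> valid_cone A K B"
    by (auto simp: valid_equation_def valid_cone_def)
  ultimately show "subspace ?M \<and> ?M \<subseteq> valid_cone A K B"
    by simp
next
  fix N
  assume N: "subspace N \<and> N \<subseteq> valid_cone A K B"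
  show "N \<subseteq> ?M"
  proof
    fix w assume "w \<in> N"
    then have "w \<in> valid_cone A K B" "- w \<in> valid_cone A K B"
      using N subspace_neg by blast+
    then show "w \<in> ?M"
      by (cases w) (auto simp: valid_equation_def valid_cone_def)
  qed
qed

end

theory Submission
  imports Defs
begin

text \<open>
  Write \<open>C\<close> for the cone of valid inequalities and \<open>L\<close> for its lineality space, the valid equations.
  The hypothesis on \<open>\<delta>\<close> says exactly that no cone-implied inequality \<open>(\<delta>, 0)\<close> with \<open>\<delta> \<noteq> 0\<close> lies in
  \<open>L\<close>.  If \<open>(\<mu>, \<eta>)\<close> is valid, \<open>\<mu> \<noteq> 0\<close>, and \<open>(\<mu>, \<eta>)\<close> is not \<open>K\<close>-minimal, then a dominating inequality
  splits it as \<open>(\<mu>, \<eta>) = (\<delta>, 0) + (\<rho>, \<eta>)\<close> with both summands in \<open>C\<close> and \<open>\<delta>\<close> a nonzero element of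
  the dual cone (lemma \<open>not_K_minimal_split\<close>).

  For a valid equation this is impossible, since then \<open>(\<delta>, 0)\<close> would satisfy
  \<open>- (\<delta>, 0) = (\<rho>, \<eta>) - (\<mu>, \<eta>) \<in> C\<close> and hence lie in \<open>L\<close>.  (An equation in \<open>G\<^sub>L\<close> has \<open>\<mu> \<noteq> 0\<close>, because
  the equations with \<open>\<mu> = 0\<close> reduce to the zero vector, which a minimal generating set omits.)

  For a generator \<open>v = (\<mu>, \<eta>)\<close> from \<open>G\<^sub>C\<close>, minimality of the generating set means that \<open>v\<close> lies outside
  the cone \<open>W\<close> generated by the other elements.  This forces each decomposition \<open>v = x + y\<close> inside
  \<open>C\<close> to be trivial modulo \<open>L\<close>, that is, \<open>x = l + a v\<close> with \<open>l \<in> L\<close> and \<open>a \<ge> 0\<close> (lemma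
  \<open>extreme_modulo_lineality\<close>).  Applied to \<open>x = (\<delta>, 0)\<close>, either \<open>a = 0\<close> and \<open>(\<delta>, 0) \<in> L\<close>, or \<open>a > 0\<close>
  and \<open>v\<close> is an \<open>L\<close>-multiple of \<open>(\<delta>, 0)\<close>, which is excluded in \<open>G\<^sub>C\<^sup>+\<close>.
\<close>

section \<open>Cones with generators\<close>

lemma convex_cone_sum:
  assumes "convex_cone S" "\<And>i. i \<in> I \<Longrightarrow> f i \<in> S"
  shows "sum f I \<in> S"
  using assms(2)
  by (induction I rule: infinite_finite_induct)
    (auto intro: convex_cone_add[OF assms(1)] convex_cone_contains_0[OF assms(1)])

lemma convex_cone_generated: "convex_cone (generated G H)"
  unfolding convex_cone_iff
proof (intro conjI ballI allI impI)
  show "0 \<in> generated G H"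
    unfolding generated_def
    by (intro CollectI exI[of _ "{}"] exI[of _ "\<lambda>_. 0"]) simp
next
  fix x y assume "x \<in> generated G H" and "y \<in> generated G H"
  then obtain S T \<alpha> c S' T' \<alpha>' c'
    where x: "x = (\<Sum>w\<in>S. \<alpha> w *\<^sub>R w) + (\<Sum>v\<in>T. c v *\<^sub>R v)"
        "finite S" "S \<subseteq> G" "finite T" "T \<subseteq> H" "\<forall>v\<in>T. 0 \<le> c v"
      and y: "y = (\<Sum>w\<in>S'. \<alpha>' w *\<^sub>R w) + (\<Sum>v\<in>T'. c' v *\<^sub>R v)"
        "finite S'" "S' \<subseteq> G" "finite T'" "T' \<subseteq> H" "\<forall>v\<in>T'. 0 \<le> c' v"
    unfolding generated_def by blast
  \<comment> \<open>Both coefficient families are extended by zero to the union of the index sets.\<close>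
  have combine: "(\<Sum>w\<in>P. p w *\<^sub>R w) + (\<Sum>w\<in>Q. q w *\<^sub>R w) =
      (\<Sum>w\<in>P \<union> Q. ((if w \<in> P then p w else 0) + (if w \<in> Q then q w else 0)) *\<^sub>R w)"
    if "finite P" "finite Q" for P Q :: "'a set" and p q
  proof -
    have "(\<Sum>w\<in>P. p w *\<^sub>R w) = (\<Sum>w\<in>P \<union> Q. (if w \<in> P then p w else 0) *\<^sub>R w)"
      using that by (intro sum.mono_neutral_cong_left) auto
    moreover have "(\<Sum>w\<in>Q. q w *\<^sub>R w) = (\<Sum>w\<in>P \<union> Q. (if w \<in> Q then q w else 0) *\<^sub>R w)"
      using that by (intro sum.mono_neutral_cong_left) auto
    ultimately show ?thesis
      by (simp add: scaleR_add_left sum.distrib)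
  qed
  have "x + y = (\<Sum>w\<in>S \<union> S'. ((if w \<in> S then \<alpha> w else 0) + (if w \<in> S' then \<alpha>' w else 0)) *\<^sub>R w) +
      (\<Sum>v\<in>T \<union> T'. ((if v \<in> T then c v else 0) + (if v \<in> T' then c' v else 0)) *\<^sub>R v)"
    unfolding x(1) y(1) combine[OF x(2) y(2), symmetric] combine[OF x(4) y(4), symmetric]
    by (simp only: ac_simps)
  moreover have "\<forall>v\<in>T \<union> T'. 0 \<le> (if v \<in> T then c v else 0) + (if v \<in> T' then c' v else 0)"
    using x(6) y(6) by simp
  ultimately show "x + y \<in> generated G H"
    unfolding generated_def using x(2-5) y(2-5)
    by (intro CollectI exI[of _ "S \<union> S'"] exI[of _ "T \<union> T'"] exI conjI) auto
next
  fix x and r :: real assume "x \<in> generated G H" and r: "0 \<le> r"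
  then obtain S T \<alpha> c
    where x: "x = (\<Sum>w\<in>S. \<alpha> w *\<^sub>R w) + (\<Sum>v\<in>T. c v *\<^sub>R v)"
        "finite S" "S \<subseteq> G" "finite T" "T \<subseteq> H" "\<forall>v\<in>T. 0 \<le> c v"
    unfolding generated_def by blast
  have "r *\<^sub>R x = (\<Sum>w\<in>S. (r * \<alpha> w) *\<^sub>R w) + (\<Sum>v\<in>T. (r * c v) *\<^sub>R v)"
    unfolding x(1) by (simp add: scaleR_right_distrib scaleR_sum_right)
  moreover have "\<forall>v\<in>T. 0 \<le> r * c v"
    using r x(6) by simp
  ultimately show "r *\<^sub>R x \<in> generated G H"
    unfolding generated_def using x(2-5)
    by (intro CollectI exI[of _ S] exI[of _ T] exI conjI) auto
qed

text \<open>Recasting the set of finite combinations as a hull makes redundancy of a generator an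
  instance of the general calculus of hull operators.\<close>

lemma generated_eq_convex_cone_hull:
  "generated G H = convex_cone hull (G \<union> uminus ` G \<union> H)" (is "_ = ?hull")
proof
  show "generated G H \<subseteq> ?hull"
  proof
    fix x assume "x \<in> generated G H"
    then obtain S T \<alpha> c
      where x: "x = (\<Sum>w\<in>S. \<alpha> w *\<^sub>R w) + (\<Sum>v\<in>T. c v *\<^sub>R v)"
          "S \<subseteq> G" "T \<subseteq> H" "\<forall>v\<in>T. 0 \<le> c v"
      unfolding generated_def by blast
    have "\<alpha> w *\<^sub>R w \<in> ?hull" if "w \<in> S" for w
    proof (cases "0 \<le> \<alpha> w")
      case True
      then show ?thesis
        using that x(2) by (intro convex_cone_hull_mul hull_inc) auto
    next
      case False
      then have "(- \<alpha> w) *\<^sub>R (- w) \<in> ?hull"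
        using that x(2) by (intro convex_cone_hull_mul hull_inc) auto
      then show ?thesis
        by simp
    qed
    moreover have "c v *\<^sub>R v \<in> ?hull" if "v \<in> T" for v
      using that x(3,4) by (intro convex_cone_hull_mul hull_inc) auto
    ultimately show "x \<in> ?hull"
      unfolding x(1)
      by (intro convex_cone_hull_add convex_cone_sum convex_cone_convex_cone_hull) auto
  qed
next
  have "w \<in> generated G H \<and> - w \<in> generated G H" if "w \<in> G" for w
  proof -
    have "r *\<^sub>R w \<in> generated G H" for r
      unfolding generated_def using that
      by (intro CollectI exI[of _ "{w}"] exI[of _ "{}"] exI[of _ "\<lambda>_. r"]) simp
    from this[of 1] this[of "-1"] show ?thesis
      by simp
  qed
  moreover have "v \<in> generated G H" if "v \<in> H" for v
    unfolding generated_def using that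
    by (intro CollectI exI[of _ "{}"] exI[of _ "{v}"] exI[of _ "\<lambda>_. 1"]) simp
  ultimately show "?hull \<subseteq> generated G H"
    by (intro hull_minimal convex_cone_generated) auto
qed

lemma generated_insert:
  assumes "x \<in> generated G (insert v H)"
  obtains w a where "w \<in> generated G H" "0 \<le> a" "x = w + a *\<^sub>R v"
proof -
  have "convex_cone hull {v} = {a *\<^sub>R v | a. 0 \<le> a}"
  proof (rule hull_unique)
    show "{v} \<subseteq> {a *\<^sub>R v | a. 0 \<le> a}"
      by (auto intro: exI[of _ 1])
    show "convex_cone {a *\<^sub>R v | a. 0 \<le> a}"
      unfolding convex_cone_iff
      by (force simp flip: scaleR_add_left intro: exI[of _ 0])
  qed (auto simp: convex_cone_scaleR)
  moreover have "G \<union> uminus ` G \<union> insert v H = (G \<union> uminus ` G \<union> H) \<union> {v}"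
    by auto
  ultimately have "x \<in> (\<Union>w\<in>generated G H. \<Union>y\<in>{a *\<^sub>R v | a. 0 \<le> a}. {w + y})"
    using assms unfolding generated_eq_convex_cone_hull
    by (simp only: convex_cone_hull_Un[of _ "{v}"])
  then show thesis
    using that by auto
qed

section \<open>Consequences of minimality of a generating set\<close>

lemma zero_notin_generating_set:
  assumes "generating_set C G H"
  shows "0 \<notin> G"
proof
  assume "0 \<in> G"
  then have "G \<union> uminus ` G \<union> H = insert 0 ((G - {0}) \<union> uminus ` (G - {0}) \<union> H)"
    by force
  then have "generated (G - {0}) H = generated G H"
    by (simp add: generated_eq_convex_cone_hull hull_redundant convex_cone_hull_contains_0)
  then have "generates C (G - {0}) H"
    using assms by (auto simp: generating_set_def generates_def)
  moreover have "G - {0} \<subseteq> G"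
    by blast
  ultimately have "G - {0} = G"
    using assms unfolding generating_set_def by blast
  with \<open>0 \<in> G\<close> show False
    by blast
qed

lemma generator_irredundant:
  assumes "generating_set C G H" "v \<in> H"
  shows "v \<notin> generated G (H - {v})"
proof
  assume "v \<in> generated G (H - {v})"
  moreover have "G \<union> uminus ` G \<union> H = insert v (G \<union> uminus ` G \<union> (H - {v}))"
    using assms(2) by blast
  ultimately have "generated G (H - {v}) = generated G H"
    by (simp add: generated_eq_convex_cone_hull hull_redundant)
  then have "generates C G (H - {v})"
    using assms(1) by (auto simp: generating_set_def generates_def)
  moreover have "H - {v} \<subseteq> H"
    by blast
  ultimately have "H - {v} = H"
    using assms(1) unfolding generating_set_def by blast
  with assms(2) show False
    by blast
qed

text \<open>Writing \<open>x = l + a v\<close> and \<open>y = m + b v\<close> with \<open>l, m\<close> in the cone generated by the other elements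
  gives \<open>(1 - a - b) v = l + m\<close>.  A positive factor on the left would make \<open>v\<close> redundant, so it is
  nonpositive, and then \<open>- l = m + (a + b - 1) v\<close> lies in \<open>C\<close> too.\<close>

lemma extreme_modulo_lineality:
  assumes gen: "generating_set C G H" and v: "v \<in> H"
    and xy: "x \<in> C" "y \<in> C" "x + y = v"
  obtains l a where "l \<in> C" "- l \<in> C" "0 \<le> a" "x = l + a *\<^sub>R v"
proof -
  define W where "W = generated G (H - {v})"
  have C: "C = generated G (insert v (H - {v}))"
    using gen v by (simp add: generating_set_def generates_def insert_absorb)
  have cone_C: "convex_cone C" and cone_W: "convex_cone W"
    unfolding C W_def by (rule convex_cone_generated)+
  have W_sub: "W \<subseteq> C"
    unfolding C W_def generated_eq_convex_cone_hull by (intro hull_mono) auto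
  have "v \<in> C"
    unfolding C generated_eq_convex_cone_hull by (intro hull_inc) auto
  obtain l a where l: "l \<in> W" "0 \<le> a" "x = l + a *\<^sub>R v"
    using xy(1) generated_insert unfolding C W_def by metis
  obtain m b where m: "m \<in> W" "0 \<le> b" "y = m + b *\<^sub>R v"
    using xy(2) generated_insert unfolding C W_def by metis
  have eq: "(1 - a - b) *\<^sub>R v = l + m"
    using xy(3) unfolding l(3) m(3) by (simp add: algebra_simps)
  have "1 \<le> a + b"
  proof (rule ccontr)
    assume "\<not> 1 \<le> a + b"
    then have pos: "0 < 1 - a - b"
      by simp
    then have "v = inverse (1 - a - b) *\<^sub>R (l + m)"
      by (simp flip: eq)
    also have "\<dots> \<in> W"
      using pos l(1) m(1) by (intro convex_cone_scaleR convex_cone_add cone_W) auto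
    finally show False
      using generator_irredundant[OF gen v] by (simp add: W_def)
  qed
  then have "m + (a + b - 1) *\<^sub>R v \<in> C"
    using m(1) W_sub \<open>v \<in> C\<close> by (intro convex_cone_scaleR convex_cone_add cone_C) auto
  also have "m + (a + b - 1) *\<^sub>R v = - l"
    using eq by (simp add: algebra_simps)
  finally show thesis
    using that l W_sub by blast
qed

section \<open>Dominated valid inequalities\<close>

text \<open>Validity survives lowering the right-hand side, so the dominating inequality may be taken with
  the same right-hand side as the dominated one; the difference is then cone-implied.\<close>

lemma not_K_minimal_split:
  assumes "valid_inequality A K B (\<mu>, \<eta>)" "\<mu> \<noteq> 0" "\<not> K_minimal A K B (\<mu>, \<eta>)"
  obtains \<delta> \<rho> where "\<delta> \<in> dual_cone K - {0}" "valid_inequality A K B (\<rho>, \<eta>)"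
    "(\<delta>, 0) + (\<rho>, \<eta>) = (\<mu>, \<eta>)"
proof -
  obtain \<rho> \<rho>\<^sub>0 where \<rho>: "valid_inequality A K B (\<rho>, \<rho>\<^sub>0)" "\<rho> \<noteq> \<mu>" "\<mu> - \<rho> \<in> dual_cone K" "\<eta> \<le> \<rho>\<^sub>0"
    using assms by (auto simp: K_minimal_def not_less)
  then have "valid_inequality A K B (\<rho>, \<eta>)"
    by (force simp: valid_inequality_def)
  with \<rho>(2,3) show thesis
    by (intro that[of "\<mu> - \<rho>" \<rho>]) auto
qed

lemma valid_inequality_cone_implied:
  assumes "\<delta> \<in> dual_cone K"
  shows "valid_inequality A K B (\<delta>, 0)"
  using assms by (auto simp: valid_inequality_def dual_cone_def feasible_set_def inner_commute)

lemma cone_implied_not_equation: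
  assumes "\<exists>x\<in>feasible_set A K B. 0 < \<delta> \<bullet> x"
  shows "\<not> valid_inequality A K B (- (\<delta>, 0))"
  using assms by (auto simp: valid_inequality_def not_le)

lemma nonzero_valid_equation_left_hand_side:
  assumes "feasible_set A K B \<noteq> {}" "valid_equation A K B (\<mu>, \<eta>)" "(\<mu>, \<eta>) \<noteq> 0"
  shows "\<mu> \<noteq> 0"
  using assms by (force simp: valid_equation_def valid_inequality_def zero_prod_def)

lemma subspace_largest_subspace_valid_cone: "subspace (largest_subspace (valid_cone A K B))"
proof -
  have "largest_subspace (valid_cone A K B) = {w. \<forall>x\<in>feasible_set A K B. fst w \<bullet> x = snd w}"
    unfolding largest_subspace_valid_cone
    by (auto simp: valid_equation_def valid_inequality_def intro: order_antisym)
  also have "subspace \<dots>"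
    by (auto simp: subspace_def inner_add_left)
  finally show ?thesis .
qed

theorem proposition2p2:
  fixes A :: "'a::euclidean_space \<Rightarrow> real ^ 'm"
    and K :: "'a set"
    and B :: "(real ^ 'm) set"
    and G\<^sub>L G\<^sub>C :: "('a \<times> real) set"
  assumes "regular_cone K"
    and "linear A"
    and "B \<noteq> {}"
    and "feasible_set A K B \<noteq> {}"
    and "feasible_set A K B \<noteq> K"
    and "generating_set (valid_cone A K B) G\<^sub>L G\<^sub>C"
    and "\<forall>\<delta>\<in>dual_cone K - {0}. \<exists>x\<in>feasible_set A K B. 0 < \<delta> \<bullet> x"
  shows "(\<forall>w\<in>G\<^sub>L. valid_equation A K B w \<longrightarrow> K_minimal A K B w) \<and>
    (\<forall>(\<mu>, \<eta>\<^sub>0)\<in>G_plus A K B G\<^sub>C. \<mu> \<noteq> 0 \<longrightarrow> K_minimal A K B (\<mu>, \<eta>\<^sub>0))"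
proof (intro conjI ballI impI)
  fix w assume w: "w \<in> G\<^sub>L" and eqn: "valid_equation A K B w"
  obtain \<mu> \<eta> where w_eq: "w = (\<mu>, \<eta>)"
    by fastforce
  have "w \<noteq> 0"
    using zero_notin_generating_set[OF assms(6)] w by blast
  then have "\<mu> \<noteq> 0"
    using nonzero_valid_equation_left_hand_side[OF assms(4)] eqn w_eq by blast
  show "K_minimal A K B w"
  proof (rule ccontr)
    assume "\<not> K_minimal A K B w"
    then obtain \<delta> \<rho> where \<delta>: "\<delta> \<in> dual_cone K - {0}" and \<rho>: "valid_inequality A K B (\<rho>, \<eta>)"
      and split: "(\<delta>, 0) + (\<rho>, \<eta>) = (\<mu>, \<eta>)"
      using not_K_minimal_split[of A K B \<mu> \<eta>] \<open>\<mu> \<noteq> 0\<close> eqn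
      unfolding w_eq valid_equation_def by auto
    have "valid_inequality A K B (- (\<delta>, 0))"
      using \<rho> eqn split unfolding w_eq
      by (force simp: valid_equation_def valid_inequality_def inner_add_left)
    then show False
      using cone_implied_not_equation assms(7) \<delta> by blast
  qed
next
  fix v assume v: "v \<in> G_plus A K B G\<^sub>C"
  obtain \<mu> \<eta> where v_eq: "v = (\<mu>, \<eta>)"
    by fastforce
  have "v \<in> G\<^sub>C"
    using v by (simp add: G_plus_def)
  then have valid: "valid_inequality A K B (\<mu>, \<eta>)"
    using assms(6) v_eq
    by (auto simp: generating_set_def generates_def pointed_part_def valid_cone_def)
  have "K_minimal A K B (\<mu>, \<eta>)" if nonzero: "\<mu> \<noteq> 0"
  proof (rule ccontr)
    assume "\<not> K_minimal A K B (\<mu>, \<eta>)"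
    then obtain \<delta> \<rho> where \<delta>: "\<delta> \<in> dual_cone K - {0}" and \<rho>: "valid_inequality A K B (\<rho>, \<eta>)"
      and split: "(\<delta>, 0) + (\<rho>, \<eta>) = v"
      unfolding v_eq using not_K_minimal_split[OF valid nonzero] by auto
    have "(\<delta>, 0) \<in> valid_cone A K B" "(\<rho>, \<eta>) \<in> valid_cone A K B"
      using \<delta> \<rho> by (auto simp: valid_cone_def valid_inequality_cone_implied)
    then obtain l a where l: "l \<in> valid_cone A K B" "- l \<in> valid_cone A K B"
      and a: "0 \<le> a" "(\<delta>, 0) = l + a *\<^sub>R v"
      using extreme_modulo_lineality[OF assms(6) \<open>v \<in> G\<^sub>C\<close>] split by metis
    let ?L = "largest_subspace (valid_cone A K B)"
    have "l \<in> ?L"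
      unfolding largest_subspace_valid_cone using l
      by (cases l) (simp add: valid_equation_def valid_cone_def)
    have "subspace ?L"
      by (rule subspace_largest_subspace_valid_cone)
    have "a \<noteq> 0"
    proof
      assume "a = 0"
      then have "valid_inequality A K B (- (\<delta>, 0))"
        using l(2) a(2) by (simp add: valid_cone_def)
      then show False
        using cone_implied_not_equation assms(7) \<delta> by blast
    qed
    have "v = inverse a *\<^sub>R (\<delta>, 0) + (- inverse a) *\<^sub>R l"
      unfolding a(2) using \<open>a \<noteq> 0\<close> by (simp add: scaleR_right_distrib)
    moreover have "(- inverse a) *\<^sub>R l \<in> ?L"
      using \<open>subspace ?L\<close> \<open>l \<in> ?L\<close> by (rule subspace_scale)
    moreover have "0 < inverse a"
      using a(1) \<open>a \<noteq> 0\<close> by simp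
    ultimately have "L_multiple ?L v (\<delta>, 0)"
      unfolding L_multiple_def by blast
    then show False
      using v \<delta> by (auto simp: G_plus_def)
  qed
  then show "case v of (\<mu>, \<eta>\<^sub>0) \<Rightarrow> \<mu> \<noteq> 0 \<longrightarrow> K_minimal A K B (\<mu>, \<eta>\<^sub>0)"
    by (simp add: v_eq)
qed

end
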